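(* Suppose that $p,q,r>1$ are real numbers satisfying $\frac1p+\frac1q+\frac1r=2$, and let $\gamma(y)=e^{-\frac12y^2}$ (which belongs to $L_r(\mathbb{R})$). For any functions $f\in L_p(\mathbb{R})$ and $g\in L_q(\mathbb{R})$, the convolution $\big(f\underset{T_c}{\overset{\gamma}{*}}g\big)(x)$ is bounded over all $x\in\mathbb{R}$, and $$\big\|f\underset{T_c}{\overset{\gamma}{*}}g\big\|_{L_\infty(\mathbb{R})}\leq\frac{1}{2\pi}\left(\sqrt{\frac{2\pi}{r}}\right)^{1/r}\|f\|_{L_p(\mathbb{R})}\|g\|_{L_q(\mathbb{R})}.$$
   Context: For functions $f,g$ on $\mathbb{R}$, the iterated Fourier-cosine convolution with Gaussian weight $\gamma(y)=e^{-\frac12y^2}$ is $$\big(f\underset{T_c}{\overset{\gamma}{*}}g\big)(x):=\frac{1}{8\pi}\int_{\mathbb{R}^2}f(u)g(v)G(x,u,v)\,du\,dv,\quad x\in\mathbb{R},$$ where $$G(x,u,v)=e^{-\frac12(x+u+v)^2}+e^{-\frac12(x+u-v)^2}+e^{-\frac12(x-u+v)^2}+e^{-\frac12(x-u-v)^2}.$$ The norm is $\|f\|_{L_\infty(\mathbb{R})}:=\operatorname{ess\,sup}_{x\in\mathbb{R}}|f(x)|$. *)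

theory Defs
  imports "HOL-Probability.Essential_Supremum"
begin

text \<open>Scalars are of a type \<open>'a\<close> of class \<open>real_normed_field\<close> and \<open>banach\<close>,
  so that the notions below apply to real-valued and to complex-valued functions alike.\<close>

definition Lp_space :: "real \<Rightarrow> (real \<Rightarrow> 'a::real_normed_vector) set" where
  "Lp_space p = {f \<in> borel_measurable lebesgue. integrable lebesgue (\<lambda>x. norm (f x) powr p)}"

definition Lp_norm :: "real \<Rightarrow> (real \<Rightarrow> 'a::real_normed_vector) \<Rightarrow> real" where
  "Lp_norm p f = (LINT x|lebesgue. norm (f x) powr p) powr (1 / p)"

text \<open>The value is \<open>\<infinity>\<close> if \<open>f\<close> is not essentially bounded, and also, by the convention of
  \<^const>\<open>esssup\<close>, if \<open>norm \<circ> f\<close> is not measurable.\<close>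

definition Linf_norm :: "(real \<Rightarrow> 'a::real_normed_vector) \<Rightarrow> ereal" where
  "Linf_norm f = esssup lebesgue (\<lambda>x. ereal (norm (f x)))"

definition gauss_weight :: "real \<Rightarrow> real" where
  "gauss_weight y = exp (- (1 / 2) * y\<^sup>2)"

definition conv_kernel :: "real \<Rightarrow> real \<Rightarrow> real \<Rightarrow> real" where
  "conv_kernel x u v = exp (- (1 / 2) * (x + u + v)\<^sup>2) + exp (- (1 / 2) * (x + u - v)\<^sup>2)
     + exp (- (1 / 2) * (x - u + v)\<^sup>2) + exp (- (1 / 2) * (x - u - v)\<^sup>2)"

definition conv_integrand ::
    "(real \<Rightarrow> 'a::real_normed_field) \<Rightarrow> (real \<Rightarrow> 'a) \<Rightarrow> real \<Rightarrow> real \<times> real \<Rightarrow> 'a" where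
  "conv_integrand f g x = (\<lambda>(u, v). f u * g v * of_real (conv_kernel x u v))"

text \<open>The integral is over the plane with its (completed) two-dimensional Lebesgue measure. It is
  \<open>0\<close> by convention wherever the integrand is not integrable, so that existence of the
  convolution at \<open>x\<close> has to be stated separately, as integrability of \<open>conv_integrand f g x\<close>.\<close>

definition fourier_cosine_conv ::
    "(real \<Rightarrow> 'a::{real_normed_field, banach, second_countable_topology}) \<Rightarrow> (real \<Rightarrow> 'a)
       \<Rightarrow> real \<Rightarrow> 'a" where
  "fourier_cosine_conv f g x =
     of_real (1 / (8 * pi)) * (LINT z|(lebesgue :: (real \<times> real) measure). conv_integrand f g x z)"

end

theory Submission
  imports Defs "HOL-Probability.Distributions"
begin

text \<open>The kernel is a sum of four Gaussians, each of which has the same \<open>L\<^sub>r\<close>-norm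
  \<open>sqrt (2 * pi / r) powr (1 / r)\<close> in either of the variables \<open>u\<close>, \<open>v\<close>. Each of the four
  integrals is bounded by a trilinear form of Young's convolution inequality: after normalising
  \<open>F\<close>, \<open>G\<close>, \<open>K\<close>, weighted AM-GM gives pointwise
  \<open>F G K \<le> (1 - 1/r) F\<^sup>p G\<^sup>q + (1 - 1/p) G\<^sup>q K\<^sup>r + (1 - 1/q) F\<^sup>p K\<^sup>r\<close>, and the right-hand side
  has integral at most \<open>(1 - 1/r) + (1 - 1/p) + (1 - 1/q) = 1\<close>. Measurability of the convolution
  in \<open>x\<close>, without which its essential supremum would be \<open>\<infinity>\<close>, comes from replacing \<open>f\<close> and \<open>g\<close>
  by Borel functions equal to them almost everywhere.\<close>

section \<open>Borel representatives of functions measurable for a completed measure\<close>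

text \<open>Simple functions \<open>s i\<close> converge to \<open>f\<close>; each agrees almost
  everywhere with an \<open>M\<close>-measurable simple function \<open>s' i\<close>, and the
  countably many exceptional null sets can be united. The pointwise \<open>lim\<close> of the
  \<open>s' i\<close> is measurable even though it takes an arbitrary default value where they
  diverge.\<close>

lemma completion_ex_borel_measurable_banach:
  fixes f :: "'a \<Rightarrow> 'b::{banach, second_countable_topology}"
  assumes "f \<in> borel_measurable (completion M)"
  obtains f' where "f' \<in> borel_measurable M" "AE x in M. f x = f' x"
proof -
  obtain s where s: "\<And>i. simple_function (completion M) (s i)"
    and lim: "\<And>x. x \<in> space M \<Longrightarrow> (\<lambda>i. s i x) \<longlonglongrightarrow> f x"
    using borel_measurable_implies_sequence_metric[OF assms, of 0] by auto
  have "\<forall>i. \<exists>s'. simple_function M s' \<and> (AE x in M. s i x = s' x)"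
    using completion_ex_simple_function[OF s] by blast
  then obtain s' where s': "\<And>i. simple_function M (s' i)" "\<And>i. AE x in M. s i x = s' i x"
    by metis
  show thesis
  proof
    show "(\<lambda>x. lim (\<lambda>i. s' i x)) \<in> borel_measurable M"
      using s'(1) by (intro borel_measurable_lim_metric borel_measurable_simple_function)
    have "AE x in M. \<forall>i. s i x = s' i x"
      using s'(2) by (simp add: AE_all_countable)
    with AE_space show "AE x in M. f x = lim (\<lambda>i. s' i x)"
    proof eventually_elim
      case (elim x)
      with lim[of x] show ?case by (simp add: limI)
    qed
  qed
qed

section \<open>Coordinate projections of the plane and completed Lebesgue measure\<close>

lemma fst_borel_measurable [simp]:
  "fst \<in> borel_measurable (borel :: ('a::topological_space \<times> 'b::topological_space) measure)"
  by (intro borel_measurable_continuous_onI continuous_intros)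

lemma snd_borel_measurable [simp]:
  "snd \<in> borel_measurable (borel :: ('a::topological_space \<times> 'b::topological_space) measure)"
  by (intro borel_measurable_continuous_onI continuous_intros)

text \<open>The strip over a null set is null in the product. This is what makes \<open>fst\<close>
  measurable between the completed measures and lets almost-everywhere statements be pulled back
  along it.\<close>

lemma null_sets_lborel_distr_fst:
  "null_sets lborel \<subseteq> null_sets (distr (lebesgue :: ('a::euclidean_space \<times> 'b::euclidean_space) measure) lborel fst)"
proof
  fix N :: "'a set" assume N: "N \<in> null_sets lborel"
  then have "N \<times> (UNIV :: 'b set) \<in> null_sets (lborel \<Otimes>\<^sub>M lborel)"
    by (intro lborel.times_in_null_sets1) auto
  then have "N \<times> (UNIV :: 'b set) \<in> null_sets lebesgue"
    by (simp add: lborel_prod null_sets_completionI)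
  moreover have "fst -` N = N \<times> (UNIV :: 'b set)" by auto
  ultimately show "N \<in> null_sets (distr (lebesgue :: ('a \<times> 'b) measure) lborel fst)"
    using N by (subst null_sets_distr_iff) (auto intro!: measurable_completion)
qed

lemma null_sets_lborel_distr_snd:
  "null_sets lborel \<subseteq> null_sets (distr (lebesgue :: ('a::euclidean_space \<times> 'b::euclidean_space) measure) lborel snd)"
proof
  fix N :: "'b set" assume N: "N \<in> null_sets lborel"
  then have "(UNIV :: 'a set) \<times> N \<in> null_sets (lborel \<Otimes>\<^sub>M lborel)"
    by (intro lborel.times_in_null_sets2) auto
  then have "(UNIV :: 'a set) \<times> N \<in> null_sets lebesgue"
    by (simp add: lborel_prod null_sets_completionI)
  moreover have "snd -` N = (UNIV :: 'a set) \<times> N" by auto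
  ultimately show "N \<in> null_sets (distr (lebesgue :: ('a \<times> 'b) measure) lborel snd)"
    using N by (subst null_sets_distr_iff) (auto intro!: measurable_completion)
qed

text \<open>Borel measurability of \<open>fst\<close> does not suffice: a Lebesgue set is Borel only
  up to a subset of a null set, and the preimage of that null set has to be null again.\<close>

lemma measurable_lebesgue_fst:
  "fst \<in> (lebesgue :: ('a::euclidean_space \<times> 'b::euclidean_space) measure) \<rightarrow>\<^sub>M lebesgue"
  by (intro completion.measurable_completion2 null_sets_lborel_distr_fst measurable_completion) simp

lemma measurable_lebesgue_snd:
  "snd \<in> (lebesgue :: ('a::euclidean_space \<times> 'b::euclidean_space) measure) \<rightarrow>\<^sub>M lebesgue"
  by (intro completion.measurable_completion2 null_sets_lborel_distr_snd measurable_completion) simp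

lemma AE_lebesgue_fst:
  assumes "AE u in lborel. P u"
  shows "AE z in (lebesgue :: ('a::euclidean_space \<times> 'b::euclidean_space) measure). P (fst z)"
proof (rule AE_distrD[where f=fst and M'=lborel])
  show "fst \<in> (lebesgue :: ('a \<times> 'b) measure) \<rightarrow>\<^sub>M lborel"
    by (intro measurable_completion) simp
  show "AE u in distr (lebesgue :: ('a \<times> 'b) measure) lborel fst. P u"
    using assms null_sets_lborel_distr_fst[where 'a='a and 'b='b]
    by (auto simp: eventually_ae_filter)
qed

lemma AE_lebesgue_snd:
  assumes "AE v in lborel. P v"
  shows "AE z in (lebesgue :: ('a::euclidean_space \<times> 'b::euclidean_space) measure). P (snd z)"
proof (rule AE_distrD[where f=snd and M'=lborel])
  show "snd \<in> (lebesgue :: ('a \<times> 'b) measure) \<rightarrow>\<^sub>M lborel"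
    by (intro measurable_completion) simp
  show "AE v in distr (lebesgue :: ('a \<times> 'b) measure) lborel snd. P v"
    using assms null_sets_lborel_distr_snd[where 'a='a and 'b='b]
    by (auto simp: eventually_ae_filter)
qed

section \<open>Weighted AM-GM and the pointwise trilinear inequality\<close>

text \<open>Concavity of \<open>ln\<close>: the value \<open>ln t\<close> lies below
  \<open>ln S + t / S - 1\<close>, the tangent at the weighted mean \<open>S\<close>. In the
  weighted sum the terms \<open>t / S\<close> add up to 1 and cancel the -1, which leaves
  \<open>ln S\<close>.\<close>

lemma weighted_arith_geom_mean3:
  fixes x y z :: real
  assumes "0 \<le> a" "0 \<le> b" "0 \<le> c" "a + b + c = 1" "0 < x" "0 < y" "0 < z"
  shows "x powr a * y powr b * z powr c \<le> a * x + b * y + c * z"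
proof -
  define S where "S = a * x + b * y + c * z"
  have "0 < S"
    using assms unfolding S_def by (smt (verit) mult_nonneg_nonneg mult_pos_pos)
  have "w * ln t \<le> w * (ln S + t / S - 1)" if "0 \<le> w" "0 < t" for w t
    using that \<open>0 < S\<close> ln_le_minus_one[of "t / S"] by (intro mult_left_mono) (simp_all add: ln_div)
  then have "a * ln x + b * ln y + c * ln z
      \<le> a * (ln S + x / S - 1) + b * (ln S + y / S - 1) + c * (ln S + z / S - 1)"
    using assms by (intro add_mono) auto
  also have "\<dots> = (a + b + c) * (ln S - 1) + (a * x + b * y + c * z) / S"
    by (simp add: algebra_simps add_divide_distrib)
  also have "\<dots> = ln S"
    using \<open>0 < S\<close> assms by (simp flip: S_def)
  finally have "exp (a * ln x + b * ln y + c * ln z) \<le> S"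
    using \<open>0 < S\<close> by (simp add: ln_ge_iff)
  then show ?thesis
    using assms by (simp add: powr_def exp_add S_def)
qed

text \<open>As \<open>a + b + c = 2\<close>, the exponent \<open>a\<close> equals
  \<open>(1 - c) + (1 - b)\<close>, and similarly for \<open>b\<close> and \<open>c\<close>. So the
  left side is a weighted geometric mean of \<open>x * y\<close>, \<open>y * z\<close>,
  \<open>x * z\<close> with weights \<open>1 - c\<close>, \<open>1 - a\<close>,
  \<open>1 - b\<close>, whose sum is 1.\<close>

lemma trilinear_Youngs_inequality:
  fixes x y z :: real
  assumes a: "0 \<le> a" "a \<le> 1" and b: "0 \<le> b" "b \<le> 1" and c: "0 \<le> c" "c \<le> 1" and "a + b + c = 2"
    and nonneg: "0 \<le> x" "0 \<le> y" "0 \<le> z"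
  shows "x powr a * y powr b * z powr c \<le> (1 - c) * (x * y) + (1 - a) * (y * z) + (1 - b) * (x * z)"
proof (cases "x = 0 \<or> y = 0 \<or> z = 0")
  case True
  \<comment> \<open>The left side vanishes, because \<open>0 powr a = 0\<close> for every
    \<open>a\<close>, including \<open>a = 0\<close>.\<close>
  then show ?thesis using assms by (auto intro!: add_nonneg_nonneg mult_nonneg_nonneg)
next
  case False
  with nonneg have pos: "0 < x" "0 < y" "0 < z" by auto
  have "x powr a * y powr b * z powr c
      = x powr ((1 - c) + (1 - b)) * y powr ((1 - c) + (1 - a)) * z powr ((1 - a) + (1 - b))"
    using \<open>a + b + c = 2\<close> by (intro arg_cong2[where f="(*)"] arg_cong2[where f="(powr)"]) auto
  also have "\<dots> = (x * y) powr (1 - c) * (y * z) powr (1 - a) * (x * z) powr (1 - b)"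
    using pos by (simp only: powr_mult powr_add less_imp_le mult_ac)
  also have "\<dots> \<le> (1 - c) * (x * y) + (1 - a) * (y * z) + (1 - b) * (x * z)"
    using assms pos by (intro weighted_arith_geom_mean3) auto
  finally show ?thesis .
qed

section \<open>Young's inequality for a general kernel on a product space\<close>

theorem (in pair_sigma_finite) trilinear_kernel_bound:
  fixes F :: "'a \<Rightarrow> real" and G :: "'b \<Rightarrow> real" and K :: "'a \<times> 'b \<Rightarrow> real"
  assumes exps: "1 \<le> p" "1 \<le> q" "1 \<le> r" "1 / p + 1 / q + 1 / r = 2"
    and [measurable]: "F \<in> borel_measurable M1" "G \<in> borel_measurable M2"
      "K \<in> borel_measurable (M1 \<Otimes>\<^sub>M M2)"
    and nonneg: "\<And>u. 0 \<le> F u" "\<And>v. 0 \<le> G v" "\<And>z. 0 \<le> K z"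
    and bounds: "0 \<le> A" "0 \<le> B" "0 < C"
    and F: "(\<integral>\<^sup>+u. ennreal (F u powr p) \<partial>M1) \<le> ennreal A"
    and G: "(\<integral>\<^sup>+v. ennreal (G v powr q) \<partial>M2) \<le> ennreal B"
    and K1: "\<And>v. v \<in> space M2 \<Longrightarrow> (\<integral>\<^sup>+u. ennreal (K (u, v) powr r) \<partial>M1) \<le> ennreal C"
    and K2: "\<And>u. u \<in> space M1 \<Longrightarrow> (\<integral>\<^sup>+v. ennreal (K (u, v) powr r) \<partial>M2) \<le> ennreal C"
  shows "(\<integral>\<^sup>+z. ennreal (F (fst z) * G (snd z) * K z) \<partial>(M1 \<Otimes>\<^sub>M M2))
    \<le> ennreal (A powr (1 / p) * B powr (1 / q) * C powr (1 / r))"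
proof -
  have iter: "(\<integral>\<^sup>+z. h z \<partial>(M1 \<Otimes>\<^sub>M M2)) = (\<integral>\<^sup>+u. \<integral>\<^sup>+v. h (u, v) \<partial>M2 \<partial>M1)"
    if "h \<in> borel_measurable (M1 \<Otimes>\<^sub>M M2)" for h
    using M2.nn_integral_fst[OF that] by simp
  \<comment> \<open>Normalising divides by \<open>A\<close> and \<open>B\<close>. If one of them is
    0, then \<open>F\<close> or \<open>G\<close> vanishes almost everywhere, and the integral on the
    left is 0.\<close>
  consider "A = 0" | "B = 0" | "0 < A" "0 < B" using bounds by linarith
  then show ?thesis
  proof cases
    case 1
    with F have "AE u in M1. ennreal (F u powr p) = 0"
      by (subst nn_integral_0_iff_AE[symmetric]) auto
    then have "AE u in M1. (\<integral>\<^sup>+v. ennreal (F u * G v * K (u, v)) \<partial>M2) = 0"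
      by eventually_elim (use nonneg in \<open>auto simp: ennreal_eq_0_iff powr_eq_0_iff\<close>)
    then show ?thesis
      by (subst iter) (simp_all add: nn_integral_cong_AE)
  next
    case 2
    with G have "AE v in M2. ennreal (G v powr q) = 0"
      by (subst nn_integral_0_iff_AE[symmetric]) auto
    then have "AE v in M2. ennreal (F u * G v * K (u, v)) = 0" for u
      by eventually_elim (use nonneg in \<open>auto simp: ennreal_eq_0_iff powr_eq_0_iff\<close>)
    then have "(\<integral>\<^sup>+v. ennreal (F u * G v * K (u, v)) \<partial>M2) = 0" if "u \<in> space M1" for u
      using that by (subst nn_integral_0_iff_AE) auto
    then show ?thesis
      by (subst iter) (auto cong: nn_integral_cong)
  next
    case 3
    \<comment> \<open>\<open>D\<close> is the claimed bound. The rescaled powers are chosen so that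
      the integrals of \<open>X\<close>, of \<open>Y\<close> and of every section of
      \<open>Z\<close> are at most 1.\<close>
    define D where "D = A powr (1 / p) * B powr (1 / q) * C powr (1 / r)"
    define X Y Z where "X u = F u powr p / A" and "Y v = G v powr q / B"
      and "Z z = K z powr r / C" for u v z
    have XYZ_nonneg: "0 \<le> X u" "0 \<le> Y v" "0 \<le> Z z" for u v z
      using 3 bounds by (auto simp: X_def Y_def Z_def)
    have [measurable]: "X \<in> borel_measurable M1" "Y \<in> borel_measurable M2"
      "Z \<in> borel_measurable (M1 \<Otimes>\<^sub>M M2)"
      unfolding X_def[abs_def] Y_def[abs_def] Z_def[abs_def] by measurable
    have scale: "(\<integral>\<^sup>+t. ennreal (h t / c) \<partial>N) \<le> 1"
      if "(\<integral>\<^sup>+t. ennreal (h t) \<partial>N) \<le> ennreal c" "0 < c" "h \<in> borel_measurable N" "\<And>t. 0 \<le> h t"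
      for N :: "'t measure" and h c
    proof -
      have "(\<integral>\<^sup>+t. ennreal (h t / c) \<partial>N) = (\<integral>\<^sup>+t. ennreal (h t) \<partial>N) / ennreal c"
        using that by (simp add: divide_ennreal[symmetric] nn_integral_divide)
      also have "\<dots> \<le> ennreal c / ennreal c"
        using that(1) by (rule divide_right_mono_ennreal)
      finally show ?thesis using that(2) by simp
    qed
    have X: "(\<integral>\<^sup>+u. ennreal (X u) \<partial>M1) \<le> 1" and Y: "(\<integral>\<^sup>+v. ennreal (Y v) \<partial>M2) \<le> 1"
      unfolding X_def Y_def using F G 3 by (auto intro!: scale)
    have Z1: "(\<integral>\<^sup>+u. ennreal (Z (u, v)) \<partial>M1) \<le> 1" if "v \<in> space M2" for v
      unfolding Z_def using K1[OF that] that bounds by (intro scale) auto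
    have Z2: "(\<integral>\<^sup>+v. ennreal (Z (u, v)) \<partial>M2) \<le> 1" if "u \<in> space M1" for u
      unfolding Z_def using K2[OF that] that bounds by (intro scale) auto

    have XY: "(\<integral>\<^sup>+z. ennreal (X (fst z) * Y (snd z)) \<partial>(M1 \<Otimes>\<^sub>M M2)) \<le> 1"
    proof -
      have "(\<integral>\<^sup>+z. ennreal (X (fst z) * Y (snd z)) \<partial>(M1 \<Otimes>\<^sub>M M2))
          = (\<integral>\<^sup>+u. ennreal (X u) * (\<integral>\<^sup>+v. ennreal (Y v) \<partial>M2) \<partial>M1)"
        by (subst iter) (simp_all add: ennreal_mult XYZ_nonneg nn_integral_cmult)
      also have "\<dots> \<le> (\<integral>\<^sup>+u. ennreal (X u) * 1 \<partial>M1)"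
        using Y by (intro nn_integral_mono mult_left_mono) auto
      finally show ?thesis using X by simp
    qed
    have XZ: "(\<integral>\<^sup>+z. ennreal (X (fst z) * Z z) \<partial>(M1 \<Otimes>\<^sub>M M2)) \<le> 1"
    proof -
      have "(\<integral>\<^sup>+z. ennreal (X (fst z) * Z z) \<partial>(M1 \<Otimes>\<^sub>M M2))
          = (\<integral>\<^sup>+u. ennreal (X u) * (\<integral>\<^sup>+v. ennreal (Z (u, v)) \<partial>M2) \<partial>M1)"
        by (subst iter)
          (simp_all add: ennreal_mult XYZ_nonneg nn_integral_cmult cong: nn_integral_cong)
      also have "\<dots> \<le> (\<integral>\<^sup>+u. ennreal (X u) * 1 \<partial>M1)"
        using Z2 by (intro nn_integral_mono mult_left_mono) auto
      finally show ?thesis using X by simp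
    qed
    \<comment> \<open>Here \<open>u\<close> is integrated first, so that \<open>Y v\<close> factors
      out and the bound on the sections of \<open>Z\<close> at fixed \<open>v\<close>
      applies.\<close>
    have YZ: "(\<integral>\<^sup>+z. ennreal (Y (snd z) * Z z) \<partial>(M1 \<Otimes>\<^sub>M M2)) \<le> 1"
    proof -
      have "(\<integral>\<^sup>+z. ennreal (Y (snd z) * Z z) \<partial>(M1 \<Otimes>\<^sub>M M2))
          = (\<integral>\<^sup>+v. \<integral>\<^sup>+u. ennreal (Y v * Z (u, v)) \<partial>M1 \<partial>M2)"
        by (subst nn_integral_snd[symmetric]) simp_all
      also have "\<dots> = (\<integral>\<^sup>+v. ennreal (Y v) * (\<integral>\<^sup>+u. ennreal (Z (u, v)) \<partial>M1) \<partial>M2)"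
        by (simp add: ennreal_mult XYZ_nonneg nn_integral_cmult cong: nn_integral_cong)
      also have "\<dots> \<le> (\<integral>\<^sup>+v. ennreal (Y v) * 1 \<partial>M2)"
        using Z1 by (intro nn_integral_mono mult_left_mono) auto
      finally show ?thesis using Y by simp
    qed

    have exps': "0 \<le> 1 / p" "1 / p \<le> 1" "0 \<le> 1 / q" "1 / q \<le> 1" "0 \<le> 1 / r" "1 / r \<le> 1"
      using exps by auto
    \<comment> \<open>Undoes the rescaling: \<open>F\<close>, \<open>G\<close>, \<open>K\<close> are
      constants with product \<open>D\<close> times the powers \<open>1 / p\<close>,
      \<open>1 / q\<close>, \<open>1 / r\<close> of \<open>X\<close>, \<open>Y\<close>,
      \<open>Z\<close>, and these exponents sum to 2.\<close>
    have root: "s = c powr (1 / e) * (s powr e / c) powr (1 / e)" if "0 \<le> s" "0 < c" "1 \<le> e" for s c e :: real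
      using that by (simp add: powr_divide powr_powr)
    have "ennreal (F (fst z) * G (snd z) * K z)
        \<le> ennreal D * (ennreal (1 - 1 / r) * ennreal (X (fst z) * Y (snd z))
            + ennreal (1 - 1 / p) * ennreal (Y (snd z) * Z z)
            + ennreal (1 - 1 / q) * ennreal (X (fst z) * Z z))" for z
    proof -
      have "F (fst z) = A powr (1 / p) * X (fst z) powr (1 / p)"
        "G (snd z) = B powr (1 / q) * Y (snd z) powr (1 / q)"
        "K z = C powr (1 / r) * Z z powr (1 / r)"
        using root nonneg 3 bounds exps by (simp_all add: X_def Y_def Z_def)
      then have "F (fst z) * G (snd z) * K z
          = D * (X (fst z) powr (1 / p) * Y (snd z) powr (1 / q) * Z z powr (1 / r))"
        by (simp only: D_def mult_ac)
      also have "\<dots> \<le> D * ((1 - 1 / r) * (X (fst z) * Y (snd z))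
          + (1 - 1 / p) * (Y (snd z) * Z z) + (1 - 1 / q) * (X (fst z) * Z z))"
        using exps(4) exps' XYZ_nonneg
        by (intro mult_left_mono trilinear_Youngs_inequality) (auto simp: D_def)
      finally have "ennreal (F (fst z) * G (snd z) * K z) \<le> ennreal (D * ((1 - 1 / r) * (X (fst z) * Y (snd z))
          + (1 - 1 / p) * (Y (snd z) * Z z) + (1 - 1 / q) * (X (fst z) * Z z)))"
        by (rule ennreal_leI)
      also have "\<dots> = ennreal D * (ennreal (1 - 1 / r) * ennreal (X (fst z) * Y (snd z))
            + ennreal (1 - 1 / p) * ennreal (Y (snd z) * Z z)
            + ennreal (1 - 1 / q) * ennreal (X (fst z) * Z z))"
      proof -
        \<comment> \<open>\<open>ennreal\<close> sends negative reals to 0; it distributes over the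
          sums and products here because every term is nonnegative.\<close>
        have "0 \<le> D" by (simp add: D_def)
        moreover have "0 \<le> X (fst z) * Y (snd z)" "0 \<le> Y (snd z) * Z z" "0 \<le> X (fst z) * Z z"
          using XYZ_nonneg by auto
        moreover have "0 \<le> 1 - 1 / r" "0 \<le> 1 - 1 / p" "0 \<le> 1 - 1 / q" using exps' by auto
        ultimately show ?thesis
          by (simp only: ennreal_mult ennreal_plus add_nonneg_nonneg mult_nonneg_nonneg)
      qed
      finally show ?thesis .
    qed
    then have "(\<integral>\<^sup>+z. ennreal (F (fst z) * G (snd z) * K z) \<partial>(M1 \<Otimes>\<^sub>M M2))
        \<le> (\<integral>\<^sup>+z. ennreal D * (ennreal (1 - 1 / r) * ennreal (X (fst z) * Y (snd z))
            + ennreal (1 - 1 / p) * ennreal (Y (snd z) * Z z)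
            + ennreal (1 - 1 / q) * ennreal (X (fst z) * Z z)) \<partial>(M1 \<Otimes>\<^sub>M M2))"
      by (intro nn_integral_mono)
    also have "\<dots> = ennreal D * (ennreal (1 - 1 / r) * (\<integral>\<^sup>+z. ennreal (X (fst z) * Y (snd z)) \<partial>(M1 \<Otimes>\<^sub>M M2))
            + ennreal (1 - 1 / p) * (\<integral>\<^sup>+z. ennreal (Y (snd z) * Z z) \<partial>(M1 \<Otimes>\<^sub>M M2))
            + ennreal (1 - 1 / q) * (\<integral>\<^sup>+z. ennreal (X (fst z) * Z z) \<partial>(M1 \<Otimes>\<^sub>M M2)))"
      by (simp add: nn_integral_cmult nn_integral_add)
    also have "\<dots> \<le> ennreal D * (ennreal (1 - 1 / r) * 1 + ennreal (1 - 1 / p) * 1 + ennreal (1 - 1 / q) * 1)"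
      using XY YZ XZ by (intro mult_left_mono add_mono) auto
    \<comment> \<open>The weights sum to \<open>3 - (1 / p + 1 / q + 1 / r) = 1\<close>, so exactly
      \<open>D\<close> remains.\<close>
    also have "ennreal (1 - 1 / r) * 1 + ennreal (1 - 1 / p) * 1 + ennreal (1 - 1 / q) * 1
        = ennreal ((1 - 1 / r) + (1 - 1 / p) + (1 - 1 / q))"
      using exps' by (simp only: ennreal_plus add_nonneg_nonneg diff_ge_0_iff_ge mult_1_right)
    also have "\<dots> = 1" using exps(4) by simp
    finally show ?thesis by (simp add: D_def)
  qed
qed

section \<open>Gaussian integrals and the convolution kernel\<close>

text \<open>Up to the factor \<open>sqrt (2 * pi / r)\<close> the integrand is the normal density
  with mean \<open>- c * s\<close> and standard deviation \<open>1 / sqrt r\<close>. The sign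
  \<open>s\<close> covers both ways in which a variable occurs in the kernel, and the result depends
  on neither \<open>c\<close> nor \<open>s\<close>.\<close>

lemma nn_integral_gauss_powr:
  fixes s c :: real
  assumes "0 < r" "\<bar>s\<bar> = 1"
  shows "(\<integral>\<^sup>+t. ennreal (gauss_weight (c + s * t) powr r) \<partial>lborel) = ennreal (sqrt (2 * pi / r))"
proof -
  have "gauss_weight (c + s * t) powr r = sqrt (2 * pi / r) * normal_density (- c * s) (1 / sqrt r) t" for t
  proof -
    have "(c + s * t)\<^sup>2 = (t - (- c * s))\<^sup>2"
      using assms(2) by (auto simp: abs_if power2_eq_square algebra_simps split: if_splits)
    then show ?thesis
      using assms(1)
      by (simp add: gauss_weight_def normal_density_def powr_def power_divide field_simps)
  qed
  then have "(\<integral>\<^sup>+t. ennreal (gauss_weight (c + s * t) powr r) \<partial>lborel)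
      = ennreal (LINT t|lborel. sqrt (2 * pi / r) * normal_density (- c * s) (1 / sqrt r) t)"
    using assms(1) by (subst nn_integral_eq_integral[symmetric]) auto
  then show ?thesis using assms(1) by simp
qed

lemma borel_measurable_gauss_weight [measurable]: "gauss_weight \<in> borel_measurable borel"
  unfolding gauss_weight_def[abs_def] by measurable

lemma gauss_weight_in_Lp_space:
  assumes "0 < r"
  shows "gauss_weight \<in> Lp_space r"
proof -
  have "integrable lborel (\<lambda>x. norm (gauss_weight x) powr r)"
    using nn_integral_gauss_powr[OF assms, of 1 0] by (intro integrableI_nonneg) (auto simp: gauss_weight_def)
  then show ?thesis
    by (auto simp: Lp_space_def integrable_completion intro: measurable_completion)
qed

text \<open>Indexing the four Gaussians by the signs of \<open>u\<close> and \<open>v\<close> lets a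
  single estimate treat them all.\<close>

lemma conv_kernel_gauss_weight:
  "conv_kernel x u v = (\<Sum>s\<in>{-1, 1}. \<Sum>t\<in>{-1, 1}. gauss_weight (x + s * u + t * v))"
  by (simp add: conv_kernel_def gauss_weight_def algebra_simps)

text \<open>Joint measurability in \<open>x\<close> and \<open>z\<close> is what makes the integral
  over \<open>z\<close> a measurable function of \<open>x\<close>.\<close>

lemma borel_measurable_conv_integrand:
  fixes f g :: "real \<Rightarrow> 'a::{real_normed_field, banach, second_countable_topology}"
  assumes [measurable]: "f \<in> borel_measurable borel" "g \<in> borel_measurable borel"
  shows "(\<lambda>(x, z). conv_integrand f g x z) \<in> borel_measurable (borel \<Otimes>\<^sub>M borel)"
  unfolding conv_integrand_def conv_kernel_def borel_prod[symmetric] by measurable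

text \<open>The integrand splits into four terms, one per Gaussian, and
  \<open>trilinear_kernel_bound\<close> gives each the same bound; hence the factor 4.\<close>

lemma nn_integral_norm_conv_integrand:
  fixes f g :: "real \<Rightarrow> 'a::{real_normed_field, banach, second_countable_topology}"
  assumes exps: "1 \<le> p" "1 \<le> q" "1 \<le> r" "1 / p + 1 / q + 1 / r = 2"
    and [measurable]: "f \<in> borel_measurable borel" "g \<in> borel_measurable borel"
    and f: "integrable lborel (\<lambda>x. norm (f x) powr p)"
    and g: "integrable lborel (\<lambda>x. norm (g x) powr q)"
  shows "(\<integral>\<^sup>+z. ennreal (norm (conv_integrand f g x z)) \<partial>lborel)
    \<le> ennreal (4 * ((LINT x|lborel. norm (f x) powr p) powr (1 / p)
        * (LINT x|lborel. norm (g x) powr q) powr (1 / q) * sqrt (2 * pi / r) powr (1 / r)))"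
proof -
  let ?D = "(LINT x|lborel. norm (f x) powr p) powr (1 / p)
        * (LINT x|lborel. norm (g x) powr q) powr (1 / q) * sqrt (2 * pi / r) powr (1 / r)"
  define T where "T s t z = norm (f (fst z)) * norm (g (snd z)) * gauss_weight (x + s * fst z + t * snd z)"
    for s t :: real and z
  have [measurable]: "T s t \<in> borel_measurable (borel \<Otimes>\<^sub>M borel)" for s t
    unfolding T_def[abs_def] by measurable
  have T_nonneg: "0 \<le> T s t z" for s t z
    by (simp add: T_def gauss_weight_def)
  have T_bound: "(\<integral>\<^sup>+z. ennreal (T s t z) \<partial>(lborel \<Otimes>\<^sub>M lborel)) \<le> ennreal ?D"
    if "\<bar>s\<bar> = 1" "\<bar>t\<bar> = 1" for s t
    unfolding T_def
  proof (rule lborel_pair.trilinear_kernel_bound[OF exps])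
    show "(\<integral>\<^sup>+u. ennreal (norm (f u) powr p) \<partial>lborel) \<le> ennreal (LINT x|lborel. norm (f x) powr p)"
      using f by (simp add: nn_integral_eq_integral)
    show "(\<integral>\<^sup>+v. ennreal (norm (g v) powr q) \<partial>lborel) \<le> ennreal (LINT x|lborel. norm (g x) powr q)"
      using g by (simp add: nn_integral_eq_integral)
    \<comment> \<open>Freezing one variable only shifts the Gaussian, so
      \<open>C = sqrt (2 * pi / r)\<close> serves all sections in both directions.\<close>
    show "(\<integral>\<^sup>+v. ennreal (gauss_weight (x + s * fst (u, v) + t * snd (u, v)) powr r) \<partial>lborel)
        \<le> ennreal (sqrt (2 * pi / r))" for u
      using nn_integral_gauss_powr[of r t "x + s * u"] exps that by simp
    show "(\<integral>\<^sup>+u. ennreal (gauss_weight (x + s * fst (u, v) + t * snd (u, v)) powr r) \<partial>lborel)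
        \<le> ennreal (sqrt (2 * pi / r))" for v
      using nn_integral_gauss_powr[of r s "x + t * v"] exps that by (simp add: algebra_simps)
  qed (use exps in \<open>auto simp: gauss_weight_def\<close>)
  have "ennreal (norm (conv_integrand f g x z))
      = ennreal (T (-1) (-1) z) + ennreal (T (-1) 1 z) + ennreal (T 1 (-1) z) + ennreal (T 1 1 z)" for z
  proof -
    have "norm (conv_integrand f g x z) = T (-1) (-1) z + T (-1) 1 z + T 1 (-1) z + T 1 1 z"
      by (cases z) (simp add: conv_integrand_def norm_mult conv_kernel_gauss_weight T_def
        gauss_weight_def algebra_simps del: of_real_add)
    then show ?thesis by (simp add: T_nonneg ennreal_plus)
  qed
  then have "(\<integral>\<^sup>+z. ennreal (norm (conv_integrand f g x z)) \<partial>lborel)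
      = (\<integral>\<^sup>+z. ennreal (T (-1) (-1) z) + ennreal (T (-1) 1 z) + ennreal (T 1 (-1) z) + ennreal (T 1 1 z)
          \<partial>(lborel \<Otimes>\<^sub>M lborel))"
    by (simp add: lborel_prod)
  also have "\<dots> = (\<integral>\<^sup>+z. ennreal (T (-1) (-1) z) \<partial>(lborel \<Otimes>\<^sub>M lborel))
      + (\<integral>\<^sup>+z. ennreal (T (-1) 1 z) \<partial>(lborel \<Otimes>\<^sub>M lborel))
      + (\<integral>\<^sup>+z. ennreal (T 1 (-1) z) \<partial>(lborel \<Otimes>\<^sub>M lborel))
      + (\<integral>\<^sup>+z. ennreal (T 1 1 z) \<partial>(lborel \<Otimes>\<^sub>M lborel))"
    by (simp add: nn_integral_add)
  also have "\<dots> \<le> ennreal ?D + ennreal ?D + ennreal ?D + ennreal ?D"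
    by (intro add_mono T_bound) auto
  also have "\<dots> = ennreal (4 * ?D)"
    by (simp flip: ennreal_plus)
  finally show ?thesis .
qed

text \<open>Changing \<open>f\<close> on a null set alters neither integrability nor the norm, and
  for a Borel function the integrals over \<open>lebesgue\<close> and \<open>lborel\<close>
  agree.\<close>

lemma Lp_space_borel_representative:
  fixes f :: "real \<Rightarrow> 'a::{real_normed_field, banach, second_countable_topology}"
  assumes "f \<in> Lp_space p"
  obtains f' where "f' \<in> borel_measurable borel" "AE x in lborel. f x = f' x"
    "integrable lborel (\<lambda>x. norm (f' x) powr p)"
    "Lp_norm p f = (LINT x|lborel. norm (f' x) powr p) powr (1 / p)"
proof -
  have meas: "f \<in> borel_measurable lebesgue"
    and int: "integrable lebesgue (\<lambda>x. norm (f x) powr p)"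
    using assms by (auto simp: Lp_space_def)
  obtain f' where "f' \<in> borel_measurable lborel" and ae: "AE x in lborel. f x = f' x"
    using completion_ex_borel_measurable_banach[OF meas] .
  then have [measurable]: "f' \<in> borel_measurable borel" by simp
  have ae': "AE x in lebesgue. norm (f x) powr p = norm (f' x) powr p"
    by (rule AE_completion) (use ae in eventually_elim, simp)
  have meas': "(\<lambda>x. norm (f' x) powr p) \<in> borel_measurable lebesgue"
    by (rule measurable_completion) simp
  have "integrable lebesgue (\<lambda>x. norm (f' x) powr p)"
    using int meas' by (rule integrable_cong_AE_imp) (use ae' in eventually_elim, simp)
  then have int': "integrable lborel (\<lambda>x. norm (f' x) powr p)"
    by (simp add: integrable_completion)
  have "(LINT x|lebesgue. norm (f x) powr p) = (LINT x|lebesgue. norm (f' x) powr p)"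
    using int meas' ae' by (intro integral_cong_AE) auto
  also have "\<dots> = (LINT x|lborel. norm (f' x) powr p)"
    by (intro integral_completion) simp
  finally show thesis
    using ae int' by (intro that[of f']) (simp_all add: Lp_norm_def)
qed

section \<open>Existence, measurability and boundedness of the convolution\<close>

theorem theorem2p2:
  fixes p q r :: real
    and f g :: "real \<Rightarrow> 'a::{real_normed_field, banach, second_countable_topology}"
  assumes "p > 1" and "q > 1" and "r > 1"
    and "1 / p + 1 / q + 1 / r = 2"
    and "f \<in> Lp_space p" and "g \<in> Lp_space q"
  shows "gauss_weight \<in> Lp_space r
    \<and> (\<forall>x. integrable (lebesgue :: (real \<times> real) measure) (conv_integrand f g x))
    \<and> bounded (range (fourier_cosine_conv f g))
    \<and> Linf_norm (fourier_cosine_conv f g)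
        \<le> ereal (1 / (2 * pi) * sqrt (2 * pi / r) powr (1 / r) * Lp_norm p f * Lp_norm q g)"
proof -
  obtain f' where f'_meas [measurable]: "f' \<in> borel_measurable borel"
    and f': "AE x in lborel. f x = f' x" "integrable lborel (\<lambda>x. norm (f' x) powr p)"
      "Lp_norm p f = (LINT x|lborel. norm (f' x) powr p) powr (1 / p)"
    using Lp_space_borel_representative[OF assms(5)] .
  obtain g' where g'_meas [measurable]: "g' \<in> borel_measurable borel"
    and g': "AE x in lborel. g x = g' x" "integrable lborel (\<lambda>x. norm (g' x) powr q)"
      "Lp_norm q g = (LINT x|lborel. norm (g' x) powr q) powr (1 / q)"
    using Lp_space_borel_representative[OF assms(6)] .
  define B where "B = 1 / (2 * pi) * sqrt (2 * pi / r) powr (1 / r) * Lp_norm p f * Lp_norm q g"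
  have joint [measurable]: "(\<lambda>(x, z). conv_integrand f' g' x z) \<in> borel_measurable (borel \<Otimes>\<^sub>M borel)"
    by (rule borel_measurable_conv_integrand) measurable
  have meas': "conv_integrand f' g' x \<in> borel_measurable borel" for x
    using measurable_compose[OF measurable_Pair1' joint, of x] by simp

  \<comment> \<open>The four Gaussians give the factor 4, and
    \<open>4 = 8 * pi * (1 / (2 * pi))\<close>; the \<open>8 * pi\<close> cancels against the
    prefactor of the convolution.\<close>
  have bound: "(\<integral>\<^sup>+z. ennreal (norm (conv_integrand f' g' x z)) \<partial>lborel) \<le> ennreal (8 * pi * B)" for x
    using nn_integral_norm_conv_integrand[OF _ _ _ assms(4) f'_meas g'_meas f'(2) g'(2), of x] assms(1-3)
    by (simp add: B_def f'(3) g'(3) mult_ac)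
  have int': "integrable lborel (conv_integrand f' g' x)" for x
    using bound[of x] meas' by (intro integrableI_bounded) (auto intro: le_less_trans)

  have [measurable]: "f \<in> borel_measurable lebesgue" "g \<in> borel_measurable lebesgue"
    using assms(5,6) by (auto simp: Lp_space_def)
  \<comment> \<open>\<open>f\<close> and \<open>g\<close> are only Lebesgue measurable, so they are
    composed with the projections as maps between completed measures.\<close>
  have meas: "conv_integrand f g x \<in> borel_measurable lebesgue" for x
  proof -
    have "(\<lambda>z. f (fst z)) \<in> borel_measurable (lebesgue :: (real \<times> real) measure)"
      "(\<lambda>z. g (snd z)) \<in> borel_measurable (lebesgue :: (real \<times> real) measure)"
      by (auto intro: measurable_compose[OF measurable_lebesgue_fst] measurable_compose[OF measurable_lebesgue_snd])
    moreover have "(\<lambda>z. of_real (conv_kernel x (fst z) (snd z)) :: 'a) \<in> borel_measurable (lebesgue :: (real \<times> real) measure)"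
      unfolding conv_kernel_def borel_prod[symmetric]
      by (intro measurable_completion) (simp add: borel_prod[symmetric])
    ultimately show ?thesis
      unfolding conv_integrand_def case_prod_beta' by (intro borel_measurable_times)
  qed
  have ae: "AE z in lebesgue. conv_integrand f g x z = conv_integrand f' g' x z" for x
    using AE_lebesgue_fst[OF f'(1), where 'b=real] AE_lebesgue_snd[OF g'(1), where 'a=real]
    by eventually_elim (simp add: conv_integrand_def case_prod_beta')
  have int: "integrable lebesgue (conv_integrand f g x)" for x
    using int'[of x] meas[of x] meas'[of x] ae[of x]
    by (subst integrable_cong_AE[OF _ _ ae]) (auto simp: integrable_completion intro: measurable_completion)
  \<comment> \<open>The exchange of \<open>f\<close>, \<open>g\<close> for \<open>f'\<close>,
    \<open>g'\<close> happens under the integral, so this equality holds at every \<open>x\<close>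
    and not merely almost everywhere.\<close>
  have conv: "fourier_cosine_conv f g x = of_real (1 / (8 * pi)) * (LINT z|lborel. conv_integrand f' g' x z)" for x
  proof -
    have "(LINT z|lebesgue. conv_integrand f g x z) = (LINT z|lebesgue. conv_integrand f' g' x z)"
      using meas[of x] meas'[of x] ae[of x] by (intro integral_cong_AE) (auto intro: measurable_completion)
    also have "\<dots> = (LINT z|lborel. conv_integrand f' g' x z)"
      using meas' by (intro integral_completion) simp
    finally show ?thesis by (simp add: fourier_cosine_conv_def)
  qed
  have norm_conv: "norm (fourier_cosine_conv f g x) \<le> B" for x
  proof -
    have "0 \<le> B" by (simp add: B_def Lp_norm_def)
    have "ennreal (norm (LINT z|lborel. conv_integrand f' g' x z)) \<le> ennreal (8 * pi * B)"
      using integral_norm_bound_ennreal[OF int'] bound by (rule order_trans)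
    then have "norm (LINT z|lborel. conv_integrand f' g' x z) \<le> 8 * pi * B"
      using \<open>0 \<le> B\<close> by (subst (asm) ennreal_le_iff) auto
    then show ?thesis
      by (simp add: conv norm_mult norm_divide field_simps)
  qed
  have "fourier_cosine_conv f g \<in> borel_measurable borel"
  proof -
    have "(\<lambda>x. LINT z|lborel. conv_integrand f' g' x z) \<in> borel_measurable borel"
      \<comment> \<open>A parameter integral of a jointly measurable function over a sigma-finite
        measure is measurable in the parameter.\<close>
      by (rule lborel.borel_measurable_lebesgue_integral) (use joint in simp)
    then show ?thesis unfolding conv[abs_def] by measurable
  qed
  then have "(\<lambda>x. ereal (norm (fourier_cosine_conv f g x))) \<in> borel_measurable lebesgue"
    by (intro measurable_completion) simp
  then have "Linf_norm (fourier_cosine_conv f g) \<le> ereal B"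
    unfolding Linf_norm_def using norm_conv by (intro esssup_I) auto
  moreover have "bounded (range (fourier_cosine_conv f g))"
    using norm_conv by (auto simp: bounded_iff)
  ultimately show ?thesis
    using int gauss_weight_in_Lp_space[of r] assms(3) by (simp add: B_def)
qed

end
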